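(* Let $X$ be an Archimedean partially ordered vector space with order unit $u$, and let $B$ be a band in $X$. Then the carrier of $\Phi(B^d)^d$ (outer disjoint complement taken in $C(\overline{\Lambda})$) is given by $$\mathrm{car}(\Phi(B^d)^d)=\Bigl(\overline{(\mathrm{sat}(\mathrm{car}(B)))^c}\Bigr)^c,$$ and $\Phi(B^d)^d$ is the largest ideal of $C(\overline{\Lambda})$ with carrier $\bigl(\overline{(\mathrm{sat}(\mathrm{car}(B)))^c}\bigr)^c$.
   Context: Let $X$ be a real vector space partially ordered by a cone $K$ (so $K$ is closed under addition and multiplication by nonnegative scalars, $K\cap(-K)=\{0\}$, and $x\le y$ iff $y-x\in K$). $X$ is Archimedean if $nx\le y$ for all $n\in\mathbb{N}$ implies $x\le 0$. An element $u\in K$ is an order unit if for each $x\in X$ there is $\alpha\ge 0$ with $-\alpha u\le x\le\alpha u$. Put $\|x\|_u=\inf\{\alpha>0\colon -\alpha u\le x\le \alpha u\}$, let $X'$ be the norm dual of $(X,\|\cdot\|_u)$ with its weak* topology, $K'=\{\varphi\in X'\colon \varphi(K)\subseteq[0,\infty)\}$, $\Sigma=\{\varphi\in K'\colon\varphi(u)=1\}$, $\Lambda$ the set of extreme points of $\Sigma$, and $\overline{\Lambda}$ the weak* closure of $\Lambda$, a compact Hausdorff space. The map $\Phi\colon X\to C(\overline{\Lambda})$ is $(\Phi(x))(\varphi)=\varphi(x)$. In a partially ordered vector space $W$ (here $W=X$ or $W=C(\overline{\Lambda})$ with pointwise order), $M^u$ is the set of upper bounds of $M\subseteq W$; $x\perp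 y$ (disjoint) means $\{x+y,-x-y\}^u=\{x-y,-x+y\}^u$; $M^d=\{y\in W\colon x\perp y\text{ for all }x\in M\}$. A linear subspace $B$ of $W$ is a band if $B^{dd}:=(B^d)^d=B$. In $C(\overline{\Lambda})$ disjointness of $f,g$ is the usual one: at every point $f$ or $g$ vanishes. For $S\subseteq C(\overline{\Lambda})$, $\mathrm{car}(S)=\{\varphi\in\overline{\Lambda}\colon s(\varphi)\ne0\text{ for some }s\in S\}$; for $B\subseteq X$, $\mathrm{car}(B):=\mathrm{car}(\Phi(B))=\{\varphi\in\overline{\Lambda}\colon\varphi(b)\neq0\text{ for some }b\in B\}$. For $M\subseteq\overline{\Lambda}$: $M^c=\overline{\Lambda}\setminus M$, and $\mathrm{sat}(M)=\overline{\Lambda}\cap\overline{\mathrm{span}(M)}$. Overlines denote weak* closures. *)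

theory Defs
  imports "HOL-Analysis.Analysis" "HOL-Library.Function_Algebras"
begin

text \<open>Pointwise scalar multiplication, so that \<open>span\<close>, \<open>subspace\<close> and \<open>extreme_point_of\<close>
  apply to sets of functionals and to sets of real-valued functions.\<close>

instantiation "fun" :: (type, real_vector) real_vector
begin

definition scaleR_fun_def: "r *\<^sub>R f = (\<lambda>x. r *\<^sub>R f x)"

instance
  by standard (simp_all add: scaleR_fun_def fun_eq_iff scaleR_add_right scaleR_add_left)

end

instance "fun" :: (type, ordered_real_vector) ordered_real_vector
  by standard
    (simp_all add: scaleR_fun_def le_fun_def scaleR_left_mono scaleR_right_mono)

text \<open>The partially ordered vector space is a linear subspace \<open>W\<close> of an ambient type, with the
  induced order; upper bounds are taken in \<open>W\<close> only.\<close>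

definition upper_bounds :: "'w::ordered_real_vector set \<Rightarrow> 'w set \<Rightarrow> 'w set" where
  "upper_bounds W M = {w \<in> W. \<forall>m\<in>M. m \<le> w}"

definition disjoint_in :: "'w::ordered_real_vector set \<Rightarrow> 'w \<Rightarrow> 'w \<Rightarrow> bool" where
  "disjoint_in W x y \<longleftrightarrow>
     upper_bounds W {x + y, - x - y} = upper_bounds W {x - y, - x + y}"

definition disjoint_compl :: "'w::ordered_real_vector set \<Rightarrow> 'w set \<Rightarrow> 'w set" where
  "disjoint_compl W M = {y \<in> W. \<forall>x\<in>M. disjoint_in W x y}"

definition is_band :: "'w::ordered_real_vector set \<Rightarrow> 'w set \<Rightarrow> bool" where
  "is_band W B \<longleftrightarrow>
     subspace B \<and> B \<subseteq> W \<and> disjoint_compl W (disjoint_compl W B) = B"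

definition is_order_unit :: "'a::ordered_real_vector \<Rightarrow> bool" where
  "is_order_unit u \<longleftrightarrow>
     0 \<le> u \<and> (\<forall>x. \<exists>\<alpha>\<ge>0. - (\<alpha> *\<^sub>R u) \<le> x \<and> x \<le> \<alpha> *\<^sub>R u)"

definition unit_norm :: "'a::ordered_real_vector \<Rightarrow> 'a \<Rightarrow> real" where
  "unit_norm u x = Inf {\<alpha>. 0 < \<alpha> \<and> - (\<alpha> *\<^sub>R u) \<le> x \<and> x \<le> \<alpha> *\<^sub>R u}"

definition norm_dual :: "'a::ordered_real_vector \<Rightarrow> ('a \<Rightarrow> real) set" where
  "norm_dual u = {\<phi>. linear \<phi> \<and> (\<exists>C. \<forall>x. \<bar>\<phi> x\<bar> \<le> C * unit_norm u x)}"

text \<open>The topology of the type \<open>'a \<Rightarrow> real\<close> is the product topology, that is, pointwise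
  convergence; its restriction to the norm dual is the weak* topology.\<close>

definition weak_star :: "'a::ordered_real_vector \<Rightarrow> ('a \<Rightarrow> real) topology" where
  "weak_star u = top_of_set (norm_dual u)"

definition dual_cone :: "'a::ordered_real_vector \<Rightarrow> ('a \<Rightarrow> real) set" where
  "dual_cone u = {\<phi> \<in> norm_dual u. \<forall>x\<ge>0. 0 \<le> \<phi> x}"

definition states :: "'a::ordered_real_vector \<Rightarrow> ('a \<Rightarrow> real) set" where
  "states u = {\<phi> \<in> dual_cone u. \<phi> u = 1}"

definition pure_states :: "'a::ordered_real_vector \<Rightarrow> ('a \<Rightarrow> real) set" where
  "pure_states u = {\<phi>. \<phi> extreme_point_of states u}"

definition Lambda_bar :: "'a::ordered_real_vector \<Rightarrow> ('a \<Rightarrow> real) set" where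
  "Lambda_bar u = weak_star u closure_of pure_states u"

text \<open>A function on \<open>Lambda_bar u\<close> is represented by its extension by zero to the whole type.
  In this way the space of continuous functions is a linear subspace of a function type, and the
  order of that type restricts to the pointwise order on \<open>Lambda_bar u\<close>.\<close>

definition cont_fun :: "'a::ordered_real_vector \<Rightarrow> (('a \<Rightarrow> real) \<Rightarrow> real) set" where
  "cont_fun u =
     {f. continuous_on (Lambda_bar u) f \<and> (\<forall>\<phi>. \<phi> \<notin> Lambda_bar u \<longrightarrow> f \<phi> = 0)}"

definition Phi :: "'a::ordered_real_vector \<Rightarrow> 'a \<Rightarrow> ('a \<Rightarrow> real) \<Rightarrow> real" where
  "Phi u x = (\<lambda>\<phi>. if \<phi> \<in> Lambda_bar u then \<phi> x else 0)"

definition car :: "'a::ordered_real_vector \<Rightarrow> (('a \<Rightarrow> real) \<Rightarrow> real) set \<Rightarrow> ('a \<Rightarrow> real) set" where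
  "car u S = {\<phi> \<in> Lambda_bar u. \<exists>s\<in>S. s \<phi> \<noteq> 0}"

definition sat :: "'a::ordered_real_vector \<Rightarrow> ('a \<Rightarrow> real) set \<Rightarrow> ('a \<Rightarrow> real) set" where
  "sat u M = Lambda_bar u \<inter> weak_star u closure_of span M"

text \<open>Ideals are order ideals of the vector lattice of continuous functions.\<close>

definition is_ideal :: "'a::ordered_real_vector \<Rightarrow> (('a \<Rightarrow> real) \<Rightarrow> real) set \<Rightarrow> bool" where
  "is_ideal u I \<longleftrightarrow> subspace I \<and> I \<subseteq> cont_fun u \<and>
     (\<forall>f\<in>cont_fun u. \<forall>g\<in>I. (\<forall>\<phi>\<in>Lambda_bar u. \<bar>f \<phi>\<bar> \<le> \<bar>g \<phi>\<bar>) \<longrightarrow> f \<in> I)"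

definition is_largest_ideal_with_car ::
    "'a::ordered_real_vector \<Rightarrow> ('a \<Rightarrow> real) set \<Rightarrow> (('a \<Rightarrow> real) \<Rightarrow> real) set \<Rightarrow> bool" where
  "is_largest_ideal_with_car u M I \<longleftrightarrow>
     is_ideal u I \<and> car u I = M \<and> (\<forall>J. is_ideal u J \<and> car u J = M \<longrightarrow> J \<subseteq> I)"

end

theory Submission
  imports Defs
begin

text \<open>
  A pure state \<open>\<phi>\<close> satisfies \<open>inf {\<phi> z | z \<ge> a, b} = max (\<phi> a) (\<phi> b)\<close>, and pure states determine
  the order, so \<open>x\<close> and \<open>y\<close> are disjoint in \<open>X\<close> iff \<open>\<phi> x * \<phi> y = 0\<close> on \<open>Lambda_bar u\<close>. Hence \<open>B\<^sup>d\<close> is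
  the annihilator of \<open>car B\<close>, and by the bipolar theorem for the weak* topology the common zeros of
  \<open>B\<^sup>d\<close> in \<open>Lambda_bar u\<close> form the set \<open>sat (car B)\<close>. So the ideal in question consists of the
  continuous functions vanishing off \<open>sat (car B)\<close>, equivalently on the closure of that complement,
  and bump functions depending on finitely many coordinates show that its carrier is as large as
  possible. The existence of pure states is obtained without topology, from a version of the
  Hahn--Banach theorem that produces extreme functionals.
\<close>

section \<open>Extreme linear functionals below a sublinear functional\<close>

text \<open>Demanding only an inequality for positive scalars suits functionals defined as infima.
  Rescaling by the inverse scalar turns it into an equality, and the scalar 2 forces the value 0 at
  the origin.\<close>

definition sublinear :: "('v::real_vector \<Rightarrow> real) \<Rightarrow> bool" where
  "sublinear p \<longleftrightarrow> (\<forall>x y. p (x + y) \<le> p x + p y) \<and> (\<forall>c>0. \<forall>x. p (c *\<^sub>R x) \<le> c * p x)"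

lemma sublinear_add: "sublinear p \<Longrightarrow> p (x + y) \<le> p x + p y"
  by (auto simp: sublinear_def)

lemma sublinear_scaleR:
  assumes "sublinear p" "0 < c"
  shows "p (c *\<^sub>R x) = c * p x"
proof (rule antisym)
  show "p (c *\<^sub>R x) \<le> c * p x" using assms by (auto simp: sublinear_def)
  have "p (inverse c *\<^sub>R (c *\<^sub>R x)) \<le> inverse c * p (c *\<^sub>R x)"
    using assms unfolding sublinear_def by (meson positive_imp_inverse_positive)
  then show "c * p x \<le> p (c *\<^sub>R x)" using assms by (simp add: field_simps)
qed

lemma sublinear_zero: "sublinear p \<Longrightarrow> p 0 = 0"
  using sublinear_scaleR[of p 2 0] by simp

lemma sublinear_minus: "sublinear p \<Longrightarrow> - p (- x) \<le> p x"
  using sublinear_add[of p x "- x"] sublinear_zero[of p] by simp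

text \<open>Writing \<open>x\<close> as \<open>(x + y) + (- y)\<close>, oddness turns subadditivity
  into the reverse inequality and also carries homogeneity over to negative scalars.\<close>

lemma sublinear_imp_linear:
  assumes p: "sublinear p" and odd: "\<And>x. p (- x) \<le> - p x"
  shows "linear p"
proof -
  have neg: "p (- x) = - p x" for x
    using odd[of x] sublinear_minus[OF p, of x] by simp
  have "p (x + y) = p x + p y" for x y
    using sublinear_add[OF p, of x y] sublinear_add[OF p, of "x + y" "- y"] neg[of y] by simp
  moreover have "p (c *\<^sub>R x) = c *\<^sub>R p x" for c x
  proof (cases c "0::real" rule: linorder_cases)
    case less
    then show ?thesis
      using sublinear_scaleR[OF p, of "- c" x] neg[of "c *\<^sub>R x"] by simp
  qed (use p in \<open>simp_all add: sublinear_zero sublinear_scaleR\<close>)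
  ultimately show ?thesis by (rule linearI)
qed

text \<open>Facial functionals are those for which the linear functionals below \<open>q\<close> form a face of the
  convex set of the linear functionals below \<open>p\<close>.\<close>

definition facial :: "('v::real_vector \<Rightarrow> real) \<Rightarrow> ('v \<Rightarrow> real) \<Rightarrow> bool" where
  "facial p q \<longleftrightarrow> (\<forall>g h t. linear g \<longrightarrow> linear h \<longrightarrow> g \<le> p \<longrightarrow> h \<le> p \<longrightarrow> 0 < t \<longrightarrow> t < 1 \<longrightarrow>
     (\<forall>x. (1 - t) * g x + t * h x \<le> q x) \<longrightarrow> g \<le> q \<and> h \<le> q)"

text \<open>The linear functionals below \<open>peak q y\<close> are those below \<open>q\<close> that agree with \<open>q\<close> at \<open>y\<close>.\<close>

definition peak :: "('v::real_vector \<Rightarrow> real) \<Rightarrow> 'v \<Rightarrow> 'v \<Rightarrow> real" where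
  "peak q y x = (INF t\<in>{0..}. q (x + t *\<^sub>R y) - t * q y)"

lemma peak_lower:
  assumes q: "sublinear q" and "0 \<le> t"
  shows "peak q y x \<le> q (x + t *\<^sub>R y) - t * q y"
  unfolding peak_def
proof (rule cINF_lower)
  show "bdd_below ((\<lambda>t. q (x + t *\<^sub>R y) - t * q y) ` {0..})"
  proof (rule bdd_belowI2)
    fix t :: real assume "t \<in> {0..}"
    then have "q (t *\<^sub>R y) = t * q y"
      using q by (cases "t = 0") (simp_all add: sublinear_zero sublinear_scaleR)
    then show "- q (- x) \<le> q (x + t *\<^sub>R y) - t * q y"
      using sublinear_add[OF q, of "x + t *\<^sub>R y" "- x"] by simp
  qed
qed (use assms in simp)

lemma peak_greatest: "(\<And>t. 0 \<le> t \<Longrightarrow> a \<le> q (x + t *\<^sub>R y) - t * q y) \<Longrightarrow> a \<le> peak q y x"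
  unfolding peak_def by (rule cINF_greatest) auto

lemma peak_le: "sublinear q \<Longrightarrow> peak q y \<le> q"
  using peak_lower[of q 0] by (simp add: le_fun_def)

lemma peak_minus:
  assumes "sublinear q"
  shows "peak q y (- y) \<le> - q y"
  using peak_lower[OF assms, of 1 y "- y"] sublinear_zero[OF assms] by simp

text \<open>The two infima range over independent parameters \<open>s\<close> and \<open>t\<close>,
  and \<open>s + t\<close> is admissible for the sum. Scaling the argument by \<open>c\<close>
  corresponds to replacing \<open>t\<close> by \<open>c * t\<close>.\<close>

lemma sublinear_peak:
  assumes q: "sublinear q"
  shows "sublinear (peak q y)"
  unfolding sublinear_def
proof safe
  fix x x'
  have "peak q y (x + x') - peak q y x \<le> peak q y x'"
  proof (rule peak_greatest)
    fix t :: real assume t: "0 \<le> t"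
    have "peak q y (x + x') - (q (x' + t *\<^sub>R y) - t * q y) \<le> peak q y x"
    proof (rule peak_greatest)
      fix s :: real assume s: "0 \<le> s"
      have "peak q y (x + x') \<le> q (x + x' + (s + t) *\<^sub>R y) - (s + t) * q y"
        using s t by (intro peak_lower q) simp
      also have "q (x + x' + (s + t) *\<^sub>R y) \<le> q (x + s *\<^sub>R y) + q (x' + t *\<^sub>R y)"
        using sublinear_add[OF q, of "x + s *\<^sub>R y" "x' + t *\<^sub>R y"]
        by (simp add: scaleR_left_distrib add_ac)
      finally show "peak q y (x + x') - (q (x' + t *\<^sub>R y) - t * q y) \<le> q (x + s *\<^sub>R y) - s * q y"
        by (simp add: algebra_simps)
    qed
    then show "peak q y (x + x') - peak q y x \<le> q (x' + t *\<^sub>R y) - t * q y" by simp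
  qed
  then show "peak q y (x + x') \<le> peak q y x + peak q y x'" by simp
next
  fix c :: real and x assume c: "0 < c"
  have "peak q y (c *\<^sub>R x) / c \<le> peak q y x"
  proof (rule peak_greatest)
    fix t :: real assume t: "0 \<le> t"
    have "peak q y (c *\<^sub>R x) \<le> q (c *\<^sub>R x + (c * t) *\<^sub>R y) - (c * t) * q y"
      using c t by (intro peak_lower q) simp
    also have "q (c *\<^sub>R x + (c * t) *\<^sub>R y) = c * q (x + t *\<^sub>R y)"
      using sublinear_scaleR[OF q c, of "x + t *\<^sub>R y"] by (simp add: scaleR_right_distrib)
    finally show "peak q y (c *\<^sub>R x) / c \<le> q (x + t *\<^sub>R y) - t * q y"
      using c by (simp add: field_simps)
  qed
  then show "peak q y (c *\<^sub>R x) \<le> c * peak q y x" using c by (simp add: field_simps)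
qed

text \<open>Evaluated at \<open>- y\<close>, the mixture is forced to reach \<open>q y\<close>.
  Since both weights are positive and \<open>g\<close>, \<open>h\<close> lie below \<open>q\<close>,
  each of them attains \<open>q y\<close>. A linear functional below \<open>q\<close> with this
  value lies below every term of the infimum defining \<open>peak q y\<close>.\<close>

lemma facial_peak:
  assumes q: "sublinear q" and f: "facial p q"
  shows "facial p (peak q y)"
  unfolding facial_def
proof (intro allI impI)
  fix g h :: "'a \<Rightarrow> real" and t :: real
  assume g: "linear g" and h: "linear h" and le: "g \<le> p" "h \<le> p" and t: "0 < t" "t < 1"
    and c: "\<forall>x. (1 - t) * g x + t * h x \<le> peak q y x"
  have "\<forall>x. (1 - t) * g x + t * h x \<le> q x"
    using c peak_le[OF q, of y] by (meson le_funD order_trans)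
  then have gh: "g \<le> q" "h \<le> q" using f g h le t unfolding facial_def by blast+
  have "(1 - t) * g (- y) + t * h (- y) \<le> - q y"
    using c peak_minus[OF q, of y] order_trans by blast
  then have *: "q y \<le> (1 - t) * g y + t * h y"
    using g h by (simp add: linear_neg)
  have 1: "(1 - t) * g y \<le> (1 - t) * q y" "t * h y \<le> t * q y"
    using gh t by (simp_all add: le_fun_def mult_left_mono)
  have "t * q y \<le> t * h y" "(1 - t) * q y \<le> (1 - t) * g y"
    using * 1 by (simp_all add: algebra_simps)
  then have eq: "g y = q y" "h y = q y"
    using 1 t gh by (simp_all add: le_fun_def order_antisym)
  have "k \<le> peak q y" if k: "linear k" "k \<le> q" "k y = q y" for k
    unfolding le_fun_def
  proof (intro allI peak_greatest)
    fix x s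
    have "k (x + s *\<^sub>R y) \<le> q (x + s *\<^sub>R y)" using k(2) by (simp add: le_fun_def)
    then show "k x \<le> q (x + s *\<^sub>R y) - s * q y"
      using k by (simp add: linear_add linear_scale)
  qed
  then show "g \<le> peak q y \<and> h \<le> peak q y" using g h gh eq by blast
qed

text \<open>This supplies the bounds of chains for Zorn's lemma. Subadditivity is where the chain
  matters: two members evaluated at different points are both dominated from below by a single
  member. The bound \<open>- p (- x)\<close> keeps the infimum finite.\<close>

lemma facial_Inf_chain:
  fixes C :: "('v::real_vector \<Rightarrow> real) set"
  assumes ne: "C \<noteq> {}" and sub: "\<And>q. q \<in> C \<Longrightarrow> sublinear q" and le: "\<And>q. q \<in> C \<Longrightarrow> q \<le> p"
    and fac: "\<And>q. q \<in> C \<Longrightarrow> facial p q"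
    and chain: "\<And>q r. q \<in> C \<Longrightarrow> r \<in> C \<Longrightarrow> q \<le> r \<or> r \<le> q"
  defines "m \<equiv> \<lambda>x. INF q\<in>C. q x"
  shows "sublinear m" "facial p m" "\<And>q. q \<in> C \<Longrightarrow> m \<le> q"
proof -
  have bdd: "bdd_below ((\<lambda>q. q x) ` C)" for x
  proof (rule bdd_belowI2)
    fix q assume "q \<in> C"
    then show "- p (- x) \<le> q x"
      using sublinear_minus[OF sub, of q x] le[of q] by (fastforce simp: le_fun_def dest: spec[of _ "- x"])
  qed
  show low: "m \<le> q" if "q \<in> C" for q
    using that bdd by (auto simp: le_fun_def m_def intro: cINF_lower)
  have gr: "a \<le> m x" if "\<And>q. q \<in> C \<Longrightarrow> a \<le> q x" for a x
    unfolding m_def using ne that by (rule cINF_greatest)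
  show "sublinear m"
    unfolding sublinear_def
  proof safe
    fix x y
    have "m (x + y) - m x \<le> m y"
    proof (rule gr)
      fix r assume r: "r \<in> C"
      have "m (x + y) - r y \<le> m x"
      proof (rule gr)
        fix q assume q: "q \<in> C"
        obtain s where s: "s \<in> C" "s \<le> q" "s \<le> r" using chain q r by blast
        have "m (x + y) \<le> s (x + y)" using low[OF s(1)] by (simp add: le_fun_def)
        also have "\<dots> \<le> s x + s y" using sublinear_add sub s by blast
        also have "\<dots> \<le> q x + r y" using s by (simp add: le_fun_def add_mono)
        finally show "m (x + y) - r y \<le> q x" by simp
      qed
      then show "m (x + y) - m x \<le> r y" by simp
    qed
    then show "m (x + y) \<le> m x + m y" by simp
  next
    fix c :: real and x assume c: "0 < c"
    have "m (c *\<^sub>R x) / c \<le> m x"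
    proof (rule gr)
      fix q assume q: "q \<in> C"
      have "m (c *\<^sub>R x) \<le> q (c *\<^sub>R x)" using low[OF q] by (simp add: le_fun_def)
      then show "m (c *\<^sub>R x) / c \<le> q x"
        using sublinear_scaleR[OF sub[OF q] c] c by (simp add: field_simps)
    qed
    then show "m (c *\<^sub>R x) \<le> c * m x" using c by (simp add: field_simps)
  qed
  show "facial p m"
    unfolding facial_def
  proof (intro allI impI)
    fix g h :: "'v \<Rightarrow> real" and t :: real
    assume g: "linear g" and h: "linear h" and gh: "g \<le> p" "h \<le> p" and t: "0 < t" "t < 1"
      and c: "\<forall>x. (1 - t) * g x + t * h x \<le> m x"
    have "g \<le> q \<and> h \<le> q" if q: "q \<in> C" for q
    proof -
      have "\<forall>x. (1 - t) * g x + t * h x \<le> q x"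
        using c low[OF q] by (meson le_funD order_trans)
      then show ?thesis using fac[OF q] g h gh t unfolding facial_def by blast
    qed
    then show "g \<le> m \<and> h \<le> m" unfolding le_fun_def by (blast intro: gr)
  qed
qed

text \<open>The Hahn--Banach theorem together with the part of the Krein--Milman theorem that yields an
  extreme maximiser. A minimal facial functional equals all its peaks and hence is linear.\<close>

theorem extremal_Hahn_Banach:
  fixes p :: "'v::real_vector \<Rightarrow> real"
  assumes p: "sublinear p"
  obtains f where "linear f" "f \<le> p" "f y = p y"
    "\<And>g h t. \<lbrakk>linear g; linear h; g \<le> p; h \<le> p; 0 < t; t < 1; \<And>x. f x = (1 - t) * g x + t * h x\<rbrakk>
      \<Longrightarrow> g = f \<and> h = f"
proof -
  \<comment> \<open>The condition at \<open>- y\<close> survives passage to smaller functionals, and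
    for a linear \<open>q\<close> below \<open>p\<close> it says that \<open>q\<close> attains
    \<open>p y\<close> at \<open>y\<close>.\<close>
  define A where "A = {q. sublinear q \<and> q \<le> p \<and> facial p q \<and> q (- y) \<le> - p y}"
  \<comment> \<open>The order is reversed, so that maximal elements for Zorn's lemma are minimal
    functionals.\<close>
  define P where "P = (\<lambda>q r :: 'v \<Rightarrow> real. r \<le> q)"
  have "facial p p" by (auto simp: facial_def)
  then have base: "peak p y \<in> A"
    using p by (simp add: A_def sublinear_peak peak_le facial_peak peak_minus)
  have "\<exists>m\<in>A. \<forall>a\<in>A. P m a \<longrightarrow> a = m"
  proof (rule predicate_Zorn)
    show "partial_order_on A (relation_of P A)"
      unfolding P_def by (rule partial_order_on_relation_ofI) auto
    fix C assume "C \<in> Chains (relation_of P A)"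
    then have C: "C \<subseteq> A" and chain: "\<And>q r. q \<in> C \<Longrightarrow> r \<in> C \<Longrightarrow> q \<le> r \<or> r \<le> q"
      by (auto simp: Chains_def relation_of_def P_def)
    show "\<exists>m\<in>A. \<forall>a\<in>C. P a m"
    proof (cases "C = {}")
      case True
      with base show ?thesis by auto
    next
      case False
      then obtain q where q: "q \<in> C" by auto
      define m where "m = (\<lambda>x. INF q\<in>C. q x)"
      have m: "sublinear m" "facial p m" "\<And>q. q \<in> C \<Longrightarrow> m \<le> q"
        unfolding m_def using False C chain by (intro facial_Inf_chain; auto simp: A_def)+
      have "q \<in> A" using q C by auto
      then have "m \<le> p" "m (- y) \<le> - p y"
        using m(3)[OF q] unfolding A_def le_fun_def by (auto intro: order_trans)
      then show ?thesis using m by (auto simp: A_def P_def)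
    qed
  qed
  then obtain f where f: "f \<in> A" and min: "\<And>q. q \<in> A \<Longrightarrow> q \<le> f \<Longrightarrow> q = f"
    by (auto simp: P_def)
  have sub: "sublinear f" and le: "f \<le> p" and fac: "facial p f" and y: "f (- y) \<le> - p y"
    using f by (auto simp: A_def)
  have "peak f x = f" for x
  proof (rule min)
    show "peak f x \<le> f" using sub by (rule peak_le)
    then show "peak f x \<in> A"
      using sub le fac y unfolding A_def
      by (auto simp: sublinear_peak facial_peak le_fun_def intro: order_trans)
  qed
  then have lin: "linear f"
    using sublinear_imp_linear[OF sub] peak_minus[OF sub] by metis
  have "p y \<le> f y" using y lin by (simp add: linear_neg)
  moreover have "g = f \<and> h = f"
    if gh: "linear g" "linear h" "g \<le> p" "h \<le> p" "0 < t" "t < 1"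
      and eq: "\<And>x. f x = (1 - t) * g x + t * h x" for g h t
  proof -
    have "g \<le> f \<and> h \<le> f" using fac gh eq unfolding facial_def by (metis order_refl)
    \<comment> \<open>A linear functional below another linear one equals it, by comparison at
      \<open>x\<close> and \<open>- x\<close>. The face below \<open>f\<close> is therefore a single
      point.\<close>
    moreover have "k = f" if k: "linear k" "k \<le> f" for k
    proof
      fix x
      have "k (- x) \<le> f (- x)" "k x \<le> f x" using k by (auto simp: le_fun_def)
      then show "k x = f x" using k lin by (simp add: linear_neg)
    qed
    ultimately show ?thesis using gh by blast
  qed
  ultimately show ?thesis using that lin le by (metis le_funD order_antisym)
qed

section \<open>Order unit spaces and pure states\<close>

lemma order_unitE:
  assumes "is_order_unit u"
  obtains \<alpha> where "0 \<le> \<alpha>" "- (\<alpha> *\<^sub>R u) \<le> x" "x \<le> \<alpha> *\<^sub>R u"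
  using assms by (auto simp: is_order_unit_def)

lemma order_unit_nonneg: "is_order_unit u \<Longrightarrow> 0 \<le> u"
  by (simp add: is_order_unit_def)

lemma positive_linear_mono:
  fixes \<phi> :: "'a::ordered_real_vector \<Rightarrow> real"
  assumes "linear \<phi>" "\<forall>x\<ge>0. 0 \<le> \<phi> x" "x \<le> y"
  shows "\<phi> x \<le> \<phi> y"
  using assms(2)[rule_format, of "y - x"] assms(1,3) by (simp add: linear_diff)

text \<open>Boundedness is automatic: a positive normalised functional maps the order interval from
  \<open>- (\<alpha> *\<^sub>R u)\<close> to \<open>\<alpha> *\<^sub>R u\<close> into the real
  interval from \<open>- \<alpha>\<close> to \<open>\<alpha>\<close>.\<close>

lemma states_iff:
  fixes u :: "'a::ordered_real_vector"
  assumes unit: "is_order_unit u"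
  shows "\<phi> \<in> states u \<longleftrightarrow> linear \<phi> \<and> (\<forall>x\<ge>0. 0 \<le> \<phi> x) \<and> \<phi> u = 1"
proof
  assume \<phi>: "linear \<phi> \<and> (\<forall>x\<ge>0. 0 \<le> \<phi> x) \<and> \<phi> u = 1"
  then have mono: "\<phi> a \<le> \<phi> b" if "a \<le> b" for a b
    using that by (blast intro: positive_linear_mono)
  have "\<bar>\<phi> x\<bar> \<le> 1 * unit_norm u x" for x
    unfolding unit_norm_def mult_1
  proof (rule cInf_greatest)
    obtain \<alpha> where \<alpha>: "0 \<le> \<alpha>" "- (\<alpha> *\<^sub>R u) \<le> x" "x \<le> \<alpha> *\<^sub>R u"
      by (rule order_unitE[OF unit])
    \<comment> \<open>The order unit may deliver \<open>\<alpha> = 0\<close>, while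
      \<open>unit_norm\<close> admits only positive bounds; hence the shift to
      \<open>\<alpha> + 1\<close>.\<close>
    have *: "\<alpha> *\<^sub>R u \<le> (\<alpha> + 1) *\<^sub>R u"
      using order_unit_nonneg[OF unit] by (intro scaleR_right_mono) auto
    have "x \<le> (\<alpha> + 1) *\<^sub>R u" by (rule order_trans[OF \<alpha>(3) *])
    moreover have "- ((\<alpha> + 1) *\<^sub>R u) \<le> x"
      by (rule order_trans[OF le_imp_neg_le[OF *] \<alpha>(2)])
    ultimately have "\<alpha> + 1 \<in> {\<alpha>. 0 < \<alpha> \<and> - (\<alpha> *\<^sub>R u) \<le> x \<and> x \<le> \<alpha> *\<^sub>R u}"
      using \<alpha>(1) by simp
    then show "{\<alpha>. 0 < \<alpha> \<and> - (\<alpha> *\<^sub>R u) \<le> x \<and> x \<le> \<alpha> *\<^sub>R u} \<noteq> {}" by (metis equals0D)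
  next
    fix \<alpha> assume "\<alpha> \<in> {\<alpha>. 0 < \<alpha> \<and> - (\<alpha> *\<^sub>R u) \<le> x \<and> x \<le> \<alpha> *\<^sub>R u}"
    then have "\<phi> (- (\<alpha> *\<^sub>R u)) \<le> \<phi> x" "\<phi> x \<le> \<phi> (\<alpha> *\<^sub>R u)"
      by (simp_all add: mono)
    then show "\<bar>\<phi> x\<bar> \<le> \<alpha>" using \<phi> by (simp add: linear_neg linear_scale)
  qed
  then have "\<exists>C. \<forall>x. \<bar>\<phi> x\<bar> \<le> C * unit_norm u x" by blast
  then show "\<phi> \<in> states u" using \<phi> by (simp add: states_def dual_cone_def norm_dual_def)
qed (auto simp: states_def dual_cone_def norm_dual_def)

lemma pure_stateD:
  fixes u :: "'a::ordered_real_vector"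
  assumes "is_order_unit u" "\<phi> \<in> pure_states u"
  shows "linear \<phi>" "\<forall>x\<ge>0. 0 \<le> \<phi> x" "\<phi> u = 1"
proof -
  have "\<phi> \<in> states u" using assms(2) unfolding pure_states_def extreme_point_of_def by blast
  then show "linear \<phi>" "\<forall>x\<ge>0. 0 \<le> \<phi> x" "\<phi> u = 1"
    by (simp_all add: states_iff[OF assms(1)])
qed

section \<open>The gauge of the order unit and the existence of pure states\<close>

text \<open>A one-sided companion of \<open>unit_norm\<close>, which may be negative. If
  \<open>u\<close> were zero, the order unit property would leave only \<open>x = 0\<close> and
  every real \<open>t\<close> would qualify, so \<open>u\<close> is taken to be nonzero
  below.\<close>

definition order_gauge :: "'a::ordered_real_vector \<Rightarrow> 'a \<Rightarrow> real" where
  "order_gauge u x = Inf {t. x \<le> t *\<^sub>R u}"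

context
  fixes u :: "'a::ordered_real_vector"
  assumes unit: "is_order_unit u" and nz: "\<not> u \<le> 0"
begin

lemma order_gauge_le:
  assumes "x \<le> t *\<^sub>R u"
  shows "order_gauge u x \<le> t"
  unfolding order_gauge_def
proof (rule cInf_lower)
  obtain \<alpha> where \<alpha>: "0 \<le> \<alpha>" "- (\<alpha> *\<^sub>R u) \<le> x" by (rule order_unitE[OF unit])
  show "bdd_below {t. x \<le> t *\<^sub>R u}"
  proof (rule bdd_belowI)
    fix t assume "t \<in> {t. x \<le> t *\<^sub>R u}"
    then have *: "- (\<alpha> *\<^sub>R u) \<le> t *\<^sub>R u" using \<alpha> by auto
    show "- \<alpha> \<le> t"
    proof (rule ccontr)
      assume "\<not> - \<alpha> \<le> t"
      \<comment> \<open>Dividing by this positive number would give \<open>u \<le> 0\<close>, which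
        is excluded.\<close>
      then have s: "0 < - (t + \<alpha>)" by simp
      have "- (t + \<alpha>) *\<^sub>R u \<le> 0" using * by (simp add: algebra_simps)
      then have "inverse (- (t + \<alpha>)) *\<^sub>R (- (t + \<alpha>) *\<^sub>R u) \<le> inverse (- (t + \<alpha>)) *\<^sub>R 0"
        using s by (intro scaleR_left_mono) auto
      then show False using s nz by (simp del: minus_add_distrib)
    qed
  qed
qed (use assms in simp)

lemma order_gauge_greatest:
  assumes "\<And>t. x \<le> t *\<^sub>R u \<Longrightarrow> a \<le> t"
  shows "a \<le> order_gauge u x"
  unfolding order_gauge_def
proof (rule cInf_greatest)
  show "{t. x \<le> t *\<^sub>R u} \<noteq> {}" using order_unitE[OF unit, of x] by (metis (mono_tags) empty_iff mem_Collect_eq)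
qed (use assms in simp)

lemma order_gauge_lessD:
  assumes "order_gauge u x < t"
  shows "x \<le> t *\<^sub>R u"
proof -
  obtain s where s: "x \<le> s *\<^sub>R u" "s < t"
    using order_gauge_greatest[of x t] assms by (meson not_less)
  have "s *\<^sub>R u \<le> t *\<^sub>R u"
    using s order_unit_nonneg[OF unit] by (intro scaleR_right_mono) auto
  with s show ?thesis by simp
qed

lemma sublinear_order_gauge: "sublinear (order_gauge u)"
  unfolding sublinear_def
proof safe
  fix x y
  have "order_gauge u (x + y) - order_gauge u x \<le> order_gauge u y"
  proof (rule order_gauge_greatest)
    fix t assume t: "y \<le> t *\<^sub>R u"
    have "order_gauge u (x + y) - t \<le> order_gauge u x"
    proof (rule order_gauge_greatest)
      fix s assume s: "x \<le> s *\<^sub>R u"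
      have "order_gauge u (x + y) \<le> s + t"
        using add_mono[OF s t] by (intro order_gauge_le) (simp add: scaleR_left_distrib)
      then show "order_gauge u (x + y) - t \<le> s" by simp
    qed
    then show "order_gauge u (x + y) - order_gauge u x \<le> t" by simp
  qed
  then show "order_gauge u (x + y) \<le> order_gauge u x + order_gauge u y" by simp
next
  fix c :: real and x assume c: "0 < c"
  have "order_gauge u (c *\<^sub>R x) / c \<le> order_gauge u x"
  proof (rule order_gauge_greatest)
    fix t assume t: "x \<le> t *\<^sub>R u"
    have "order_gauge u (c *\<^sub>R x) \<le> c * t"
      using scaleR_left_mono[OF t, of c] c by (intro order_gauge_le) simp
    then show "order_gauge u (c *\<^sub>R x) / c \<le> t" using c by (simp add: field_simps)
  qed
  then show "order_gauge u (c *\<^sub>R x) \<le> c * order_gauge u x" using c by (simp add: field_simps)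
qed

text \<open>This makes the states accessible to Hahn--Banach. For \<open>0 \<le> x\<close> the gauge
  of \<open>- x\<close> is at most 0, which yields positivity; the bounds 1 at \<open>u\<close> and
  -1 at \<open>- u\<close> yield normalisation.\<close>

lemma states_eq_order_gauge: "states u = {\<phi>. linear \<phi> \<and> \<phi> \<le> order_gauge u}"
proof (intro set_eqI iffI)
  fix \<phi> assume "\<phi> \<in> states u"
  then have \<phi>: "linear \<phi>" "\<forall>x\<ge>0. 0 \<le> \<phi> x" "\<phi> u = 1"
    by (simp_all add: states_iff[OF unit])
  have "\<phi> x \<le> order_gauge u x" for x
  proof (rule order_gauge_greatest)
    fix t assume "x \<le> t *\<^sub>R u"
    with \<phi>(1,2) have "\<phi> x \<le> \<phi> (t *\<^sub>R u)" by (rule positive_linear_mono)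
    then show "\<phi> x \<le> t" using \<phi> by (simp add: linear_scale)
  qed
  then show "\<phi> \<in> {\<phi>. linear \<phi> \<and> \<phi> \<le> order_gauge u}" using \<phi> by (simp add: le_fun_def)
next
  fix \<phi> assume "\<phi> \<in> {\<phi>. linear \<phi> \<and> \<phi> \<le> order_gauge u}"
  then have \<phi>: "linear \<phi>" "\<And>x. \<phi> x \<le> order_gauge u x" by (auto simp: le_fun_def)
  have "0 \<le> \<phi> x" if "0 \<le> x" for x
    using \<phi>(2)[of "- x"] order_gauge_le[of "- x" 0] that by (simp add: linear_neg[OF \<phi>(1)])
  moreover have "\<phi> u = 1"
    using \<phi>(2)[of u] \<phi>(2)[of "- u"] order_gauge_le[of u 1] order_gauge_le[of "- u" "- 1"]
    by (simp add: linear_neg[OF \<phi>(1)])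
  ultimately show "\<phi> \<in> states u" using \<phi>(1) by (simp add: states_iff[OF unit])
qed

lemma ex_pure_state_order_gauge:
  obtains \<phi> where "\<phi> \<in> pure_states u" "\<phi> x = order_gauge u x"
proof -
  obtain f where f: "linear f" "f \<le> order_gauge u" "f x = order_gauge u x"
    and ext: "\<And>g h t. \<lbrakk>linear g; linear h; g \<le> order_gauge u; h \<le> order_gauge u; 0 < t; t < 1;
        \<And>x. f x = (1 - t) * g x + t * h x\<rbrakk> \<Longrightarrow> g = f \<and> h = f"
    using extremal_Hahn_Banach[OF sublinear_order_gauge] by metis
  have "f extreme_point_of states u"
    unfolding extreme_point_of_def states_eq_order_gauge
  proof (intro conjI ballI notI)
    fix g h assume gh: "g \<in> {\<phi>. linear \<phi> \<and> \<phi> \<le> order_gauge u}" "h \<in> {\<phi>. linear \<phi> \<and> \<phi> \<le> order_gauge u}"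
      and "f \<in> open_segment g h"
    then obtain t where t: "g \<noteq> h" "0 < t" "t < 1" "f = (1 - t) *\<^sub>R g + t *\<^sub>R h"
      by (auto simp: in_segment)
    have "f x = (1 - t) * g x + t * h x" for x
      using fun_cong[OF t(4), of x] by (simp add: scaleR_fun_def)
    then have "g = f \<and> h = f" using ext[of g h t] gh t(2,3) by blast
    with t(1) show False by simp
  qed (use f in simp)
  then show ?thesis using that f by (simp add: pure_states_def)
qed

end

text \<open>Some pure state attains the gauge at \<open>- x\<close>, so that gauge is at most 0.
  Then \<open>- x\<close> lies below every positive multiple of \<open>u\<close>, and the
  Archimedean property applies. For \<open>u = 0\<close> the space is trivial.\<close>

lemma pure_states_determine_order:
  fixes u :: "'a::ordered_real_vector"
  assumes archimedean: "\<forall>x y :: 'a. (\<forall>n::nat. real n *\<^sub>R x \<le> y) \<longrightarrow> x \<le> 0"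
    and unit: "is_order_unit u"
    and pos: "\<And>\<phi>. \<phi> \<in> pure_states u \<Longrightarrow> 0 \<le> \<phi> x"
  shows "0 \<le> x"
proof (cases "u \<le> 0")
  case True
  then have "u = 0" using order_unit_nonneg[OF unit] by (rule antisym)
  moreover obtain \<alpha> where "- (\<alpha> *\<^sub>R u) \<le> x" by (rule order_unitE[OF unit])
  ultimately show ?thesis by simp
next
  case False
  obtain \<phi> where \<phi>: "\<phi> \<in> pure_states u" "\<phi> (- x) = order_gauge u (- x)"
    using ex_pure_state_order_gauge[OF unit False] by blast
  have "linear \<phi>" by (rule pure_stateD[OF unit \<phi>(1)])
  then have g: "order_gauge u (- x) \<le> 0" using pos[OF \<phi>(1)] \<phi>(2) by (simp add: linear_neg)
  have "real n *\<^sub>R (- x) \<le> u" for n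
  \<comment> \<open>Since \<open>inverse 0 = 0\<close>, the strict bound on the gauge used below is
    available only for nonzero \<open>n\<close>.\<close>
  proof (cases "n = 0")
    case True
    then show ?thesis using order_unit_nonneg[OF unit] by simp
  next
    case False
    then have "order_gauge u (- x) < inverse (real n)" using g by (auto intro: le_less_trans)
    then have "- x \<le> inverse (real n) *\<^sub>R u" by (rule order_gauge_lessD[OF unit \<open>\<not> u \<le> 0\<close>])
    then have "real n *\<^sub>R (- x) \<le> real n *\<^sub>R (inverse (real n) *\<^sub>R u)"
      by (intro scaleR_left_mono) auto
    then show ?thesis using False by simp
  qed
  then have "- x \<le> 0" using archimedean by blast
  then show ?thesis by simp
qed

section \<open>Extremality of pure states and disjointness in the ordered space\<close>

text \<open>When \<open>F u\<close> and \<open>G u\<close> are both positive, normalising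
  \<open>F\<close> and \<open>G\<close> exhibits \<open>\<phi>\<close> as a proper convex
  combination of states, which must coincide. In the remaining cases a positive functional vanishing
  at the order unit is zero.\<close>

lemma pure_state_proportional:
  fixes u :: "'a::ordered_real_vector"
  assumes unit: "is_order_unit u" and pure: "\<phi> \<in> pure_states u"
    and F: "linear F" "\<forall>x\<ge>0. 0 \<le> F x" and G: "linear G" "\<forall>x\<ge>0. 0 \<le> G x"
    and sum: "\<And>x. F x + G x = \<phi> x"
  shows "F x = F u * \<phi> x"
proof -
  have vanish: "H x = 0" if H: "linear H" "\<forall>x\<ge>0. 0 \<le> H x" "H u = 0" for H :: "'a \<Rightarrow> real" and x
  proof -
    obtain \<alpha> where "- (\<alpha> *\<^sub>R u) \<le> x" "x \<le> \<alpha> *\<^sub>R u" by (rule order_unitE[OF unit])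
    then have "H (- (\<alpha> *\<^sub>R u)) \<le> H x" "H x \<le> H (\<alpha> *\<^sub>R u)"
      using H by (blast intro: positive_linear_mono)+
    then show ?thesis using H by (simp add: linear_neg linear_scale)
  qed
  have ext: "\<phi> extreme_point_of states u" using pure by (simp add: pure_states_def)
  have "\<phi> u = 1" by (rule pure_stateD[OF unit pure])
  then have FG: "F u + G u = 1" using sum by metis
  have "0 \<le> F u" "0 \<le> G u" using F G order_unit_nonneg[OF unit] by auto
  then consider "F u = 0" | "G u = 0" | "0 < F u" "0 < G u" by linarith
  then show ?thesis
  proof cases
    case 1
    then show ?thesis using vanish[OF F] by simp
  next
    case 2
    then show ?thesis using vanish[OF G 2] FG sum[of x] by simp
  next
    case 3
    define f g where "f = (\<lambda>x. F x / F u)" and "g = (\<lambda>x. G x / G u)"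
    have "linear f" "linear g"
      unfolding f_def g_def using F(1) G(1)
      by (auto intro!: linearI simp: linear_add linear_scale add_divide_distrib)
    then have fg: "f \<in> states u" "g \<in> states u"
      using 3 F G states_iff[OF unit] by (auto simp: f_def g_def)
    have "\<phi> = (1 - F u) *\<^sub>R g + F u *\<^sub>R f"
    proof
      fix x
      show "\<phi> x = ((1 - F u) *\<^sub>R g + F u *\<^sub>R f) x"
        using 3 FG sum[of x] by (simp add: scaleR_fun_def f_def g_def flip: FG)
    qed
    then have "g \<noteq> f \<Longrightarrow> \<phi> \<in> open_segment g f"
      using 3 FG by (auto simp: in_segment intro!: exI[of _ "F u"])
    then have "g = f" using ext fg by (auto simp: extreme_point_of_def)
    then have "\<phi> = f" using \<open>\<phi> = _\<close> by (simp add: algebra_simps flip: scaleR_left_distrib)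
    then show ?thesis using 3 by (simp add: f_def)
  qed
qed

text \<open>In a general partially ordered space \<open>a\<close> and \<open>b\<close> have no supremum, but a pure state sees
  their common upper bounds as if they had one. The infimum is a sublinear functional of
  \<open>(a, b)\<close>; a linear functional touching it from below splits into two positive functionals with
  sum \<open>\<phi>\<close>, and extremality makes both of them multiples of \<open>\<phi>\<close>.\<close>

lemma pure_state_Inf_upper_bounds:
  fixes u :: "'a::ordered_real_vector"
  assumes unit: "is_order_unit u" and pure: "\<phi> \<in> pure_states u"
  shows "(INF z\<in>upper_bounds UNIV {a, b}. \<phi> z) = max (\<phi> a) (\<phi> b)"
proof -
  define p where "p = (\<lambda>(a, b). INF z\<in>upper_bounds UNIV {a, b}. \<phi> z)"
  note \<phi> = pure_stateD[OF unit pure]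
  have mono: "x \<le> y \<Longrightarrow> \<phi> x \<le> \<phi> y" for x y
    by (rule positive_linear_mono[OF \<phi>(1,2)])
  have low: "p (a, b) \<le> \<phi> z" if "a \<le> z" "b \<le> z" for a b z
    unfolding p_def prod.case
  proof (rule cINF_lower)
    show "bdd_below (\<phi> ` upper_bounds UNIV {a, b})"
      by (rule bdd_belowI2[of _ "\<phi> a"]) (auto simp: upper_bounds_def intro: mono)
  qed (use that in \<open>simp add: upper_bounds_def\<close>)
  have gr: "c \<le> p (a, b)" if "\<And>z. a \<le> z \<Longrightarrow> b \<le> z \<Longrightarrow> c \<le> \<phi> z" for a b c
    unfolding p_def prod.case
  proof (rule cINF_greatest)
    obtain \<alpha> where \<alpha>: "0 \<le> \<alpha>" "a \<le> \<alpha> *\<^sub>R u" by (rule order_unitE[OF unit])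
    obtain \<beta> where \<beta>: "0 \<le> \<beta>" "b \<le> \<beta> *\<^sub>R u" by (rule order_unitE[OF unit])
    have "0 \<le> \<alpha> *\<^sub>R u" "0 \<le> \<beta> *\<^sub>R u"
      using \<alpha> \<beta> order_unit_nonneg[OF unit] by (simp_all add: scaleR_nonneg_nonneg)
    then have "\<alpha> *\<^sub>R u + \<beta> *\<^sub>R u \<in> upper_bounds UNIV {a, b}"
      using \<alpha> \<beta> add_mono[of a "\<alpha> *\<^sub>R u" 0 "\<beta> *\<^sub>R u"] add_mono[of 0 "\<alpha> *\<^sub>R u" b "\<beta> *\<^sub>R u"]
      by (simp add: upper_bounds_def)
    then show "upper_bounds UNIV {a, b} \<noteq> {}" by blast
  qed (use that in \<open>simp add: upper_bounds_def\<close>)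
  have "sublinear p"
    unfolding sublinear_def
  proof safe
    fix a b a' b' :: 'a
    have "p (a + a', b + b') - p (a, b) \<le> p (a', b')"
    proof (rule gr)
      fix z' assume z': "a' \<le> z'" "b' \<le> z'"
      have "p (a + a', b + b') - \<phi> z' \<le> p (a, b)"
      proof (rule gr)
        fix z assume z: "a \<le> z" "b \<le> z"
        have "p (a + a', b + b') \<le> \<phi> (z + z')" using z z' by (intro low add_mono)
        then show "p (a + a', b + b') - \<phi> z' \<le> \<phi> z" using \<phi> by (simp add: linear_add)
      qed
      then show "p (a + a', b + b') - p (a, b) \<le> \<phi> z'" by simp
    qed
    then show "p ((a, b) + (a', b')) \<le> p (a, b) + p (a', b')" by simp
  next
    fix c :: real and a b :: 'a assume c: "0 < c"
    have "p (c *\<^sub>R a, c *\<^sub>R b) / c \<le> p (a, b)"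
    proof (rule gr)
      fix z assume "a \<le> z" "b \<le> z"
      then have "p (c *\<^sub>R a, c *\<^sub>R b) \<le> \<phi> (c *\<^sub>R z)"
        using c by (intro low scaleR_left_mono) auto
      then show "p (c *\<^sub>R a, c *\<^sub>R b) / c \<le> \<phi> z"
        using c \<phi> by (simp add: linear_scale field_simps)
    qed
    then show "p (c *\<^sub>R (a, b)) \<le> c * p (a, b)" using c by (simp add: field_simps)
  qed
  then obtain f where f: "linear f" "f \<le> p" "f (a, b) = p (a, b)"
    by (rule extremal_Hahn_Banach)
  define F G where "F = (\<lambda>x. f (x, 0))" and "G = (\<lambda>x. f (0, x))"
  have add: "f (x + x', y + y') = f (x, y) + f (x', y')" for x x' y y'
    using linear_add[OF f(1), of "(x, y)" "(x', y')"] by simp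
  have scale: "f (c *\<^sub>R x, c *\<^sub>R y) = c * f (x, y)" for c x y
    using linear_scale[OF f(1), of c "(x, y)"] by simp
  have lin: "linear F" "linear G"
    unfolding F_def G_def using add[of _ _ 0 0] add[of 0 0] scale[of _ _ 0] scale[of _ 0]
    by (auto intro!: linearI)
  have bound: "f (x, y) \<le> \<phi> z" if "x \<le> z" "y \<le> z" for x y z
    using low[OF that] f(2) by (meson le_funD order_trans)
  \<comment> \<open>For \<open>0 \<le> x\<close>, the element 0 is a common upper bound of
    \<open>- x\<close> and 0, so \<open>f\<close> is at most 0 at \<open>(- x, 0)\<close> and
    \<open>(0, - x)\<close>.\<close>
  have "0 \<le> F x \<and> 0 \<le> G x" if "0 \<le> x" for x
    using that bound[of "- x" 0 0] bound[of 0 0 "- x"] linear_neg[OF lin(1), of x]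
      linear_neg[OF lin(2), of x] linear_0[OF \<phi>(1)] by (simp add: F_def G_def)
  then have pos: "\<forall>x\<ge>0. 0 \<le> F x" "\<forall>x\<ge>0. 0 \<le> G x" by blast+
  have split: "f (x, y) = F x + G y" for x y
    using add[of x 0 0 y] by (simp add: F_def G_def)
  \<comment> \<open>On the diagonal \<open>x\<close> itself is a common upper bound; applying this
    to \<open>x\<close> and to \<open>- x\<close> gives both inequalities.\<close>
  have sum: "F x + G x = \<phi> x" for x
    using bound[of x x x] bound[of "- x" "- x" "- x"] linear_neg[OF lin(1), of x]
      linear_neg[OF lin(2), of x] linear_neg[OF \<phi>(1), of x] by (simp add: split)
  then have sum': "G x + F x = \<phi> x" for x
    by (metis add.commute)
  have "F x = F u * \<phi> x" for x
    using pure_state_proportional[OF unit pure lin(1) pos(1) lin(2) pos(2) sum] .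
  moreover have "G x = G u * \<phi> x" for x
    using pure_state_proportional[OF unit pure lin(2) pos(2) lin(1) pos(1) sum'] .
  \<comment> \<open>The weights \<open>F u\<close> and \<open>G u\<close> are nonnegative with sum
    1, so the infimum is a convex combination of \<open>\<phi> a\<close> and
    \<open>\<phi> b\<close>.\<close>
  ultimately have "p (a, b) = F u * \<phi> a + G u * \<phi> b" using f(3) split by metis
  also have "\<dots> \<le> F u * max (\<phi> a) (\<phi> b) + G u * max (\<phi> a) (\<phi> b)"
    using pos order_unit_nonneg[OF unit] by (intro add_mono mult_left_mono) auto
  also have "\<dots> = max (\<phi> a) (\<phi> b)"
    using sum[of u] \<phi>(3) by (simp flip: distrib_right)
  finally have "p (a, b) \<le> max (\<phi> a) (\<phi> b)" .
  moreover have "max (\<phi> a) (\<phi> b) \<le> p (a, b)" by (rule gr) (simp add: mono)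
  ultimately show ?thesis unfolding p_def prod.case by (rule antisym)
qed

lemma abs_add_eq_abs_diff_iff: "\<bar>a + b\<bar> = \<bar>a - b\<bar> \<longleftrightarrow> a * b = 0" for a b :: real
  by (auto simp: abs_eq_iff)

text \<open>A pure state turns the common upper bounds of \<open>v\<close> and \<open>- v\<close>
  into the absolute value of \<open>\<phi> v\<close>, so equal sets of upper bounds give equal
  absolute values. Conversely, pure states determine the order, so these absolute values determine
  the upper bounds.\<close>

lemma disjoint_iff_pure_states:
  fixes u :: "'a::ordered_real_vector"
  assumes archimedean: "\<forall>x y :: 'a. (\<forall>n::nat. real n *\<^sub>R x \<le> y) \<longrightarrow> x \<le> 0"
    and unit: "is_order_unit u"
  shows "disjoint_in UNIV x y \<longleftrightarrow> (\<forall>\<phi>\<in>pure_states u. \<phi> x * \<phi> y = 0)"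
proof
  assume d: "disjoint_in UNIV x y"
  show "\<forall>\<phi>\<in>pure_states u. \<phi> x * \<phi> y = 0"
  proof
    fix \<phi> assume pure: "\<phi> \<in> pure_states u"
    then have lin: "linear \<phi>" by (rule pure_stateD[OF unit])
    have "max (\<phi> (x + y)) (\<phi> (- x - y)) = max (\<phi> (x - y)) (\<phi> (- x + y))"
      using d unfolding disjoint_in_def by (simp flip: pure_state_Inf_upper_bounds[OF unit pure])
    then have "\<bar>\<phi> x + \<phi> y\<bar> = \<bar>\<phi> x - \<phi> y\<bar>"
      using lin by (simp add: linear_add linear_diff linear_neg abs_real_def max_def split: if_splits)
    then show "\<phi> x * \<phi> y = 0" by (simp only: abs_add_eq_abs_diff_iff)
  qed
next
  assume z: "\<forall>\<phi>\<in>pure_states u. \<phi> x * \<phi> y = 0"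
  have le: "a \<le> w" if "v \<le> w" "- v \<le> w" and abs: "\<And>\<phi>. \<phi> \<in> pure_states u \<Longrightarrow> \<bar>\<phi> a\<bar> = \<bar>\<phi> v\<bar>" for a v w
  proof -
    have "0 \<le> w - a"
    proof (rule pure_states_determine_order[OF archimedean unit])
      fix \<phi> assume pure: "\<phi> \<in> pure_states u"
      note \<phi> = pure_stateD[OF unit pure]
      have "\<phi> v \<le> \<phi> w" "\<phi> (- v) \<le> \<phi> w"
        using that \<phi> by (blast intro: positive_linear_mono)+
      then show "0 \<le> \<phi> (w - a)"
        using abs[OF pure] \<phi>(1) by (simp add: linear_diff linear_neg)
    qed
    then show ?thesis by simp
  qed
  have abs: "\<bar>\<phi> (x + y)\<bar> = \<bar>\<phi> (x - y)\<bar>" if pure: "\<phi> \<in> pure_states u" for \<phi>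
  proof -
    have "\<bar>\<phi> x + \<phi> y\<bar> = \<bar>\<phi> x - \<phi> y\<bar>"
      using z pure by (simp only: abs_add_eq_abs_diff_iff)
    then show ?thesis using pure_stateD(1)[OF unit pure] by (simp add: linear_add linear_diff)
  qed
  have sub: "upper_bounds UNIV {v, - v} \<subseteq> upper_bounds UNIV {a, - a}"
    if "\<And>\<phi>. \<phi> \<in> pure_states u \<Longrightarrow> \<bar>\<phi> a\<bar> = \<bar>\<phi> v\<bar>" for a v
  proof
    fix w assume "w \<in> upper_bounds UNIV {v, - v}"
    then have w: "v \<le> w" "- v \<le> w" by (simp_all add: upper_bounds_def)
    have "\<bar>\<phi> (- a)\<bar> = \<bar>\<phi> v\<bar>" if pure: "\<phi> \<in> pure_states u" for \<phi>
      using that \<open>\<And>\<phi>. \<phi> \<in> pure_states u \<Longrightarrow> \<bar>\<phi> a\<bar> = \<bar>\<phi> v\<bar>\<close> pure_stateD(1)[OF unit pure]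
      by (simp add: linear_neg)
    then have "a \<le> w" "- a \<le> w" using le[OF w] that by blast+
    then show "w \<in> upper_bounds UNIV {a, - a}" by (simp add: upper_bounds_def)
  qed
  have "upper_bounds UNIV {x + y, - (x + y)} = upper_bounds UNIV {x - y, - (x - y)}"
    using sub[of "x - y" "x + y"] sub[of "x + y" "x - y"] abs by (simp add: order_antisym)
  then show "disjoint_in UNIV x y" by (simp add: disjoint_in_def)
qed

section \<open>The weak* topology\<close>

lemma norm_dual_linear: "\<phi> \<in> norm_dual u \<Longrightarrow> linear \<phi>"
  by (simp add: norm_dual_def)

lemma subspace_norm_dual: "subspace (norm_dual u)"
  unfolding subspace_def
proof (intro conjI ballI allI)
  have "\<forall>x. \<bar>(0 :: 'a \<Rightarrow> real) x\<bar> \<le> 0 * unit_norm u x" by simp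
  moreover have "linear (0 :: 'a \<Rightarrow> real)" by (intro linearI) simp_all
  ultimately show "0 \<in> norm_dual u" unfolding norm_dual_def by blast
next
  fix \<phi> \<psi> assume "\<phi> \<in> norm_dual u" "\<psi> \<in> norm_dual u"
  then obtain C D where lin: "linear \<phi>" "linear \<psi>"
    and C: "\<And>x. \<bar>\<phi> x\<bar> \<le> C * unit_norm u x" and D: "\<And>x. \<bar>\<psi> x\<bar> \<le> D * unit_norm u x"
    by (auto simp: norm_dual_def)
  have "\<bar>(\<phi> + \<psi>) x\<bar> \<le> (C + D) * unit_norm u x" for x
    using add_mono[OF C[of x] D[of x]] abs_triangle_ineq[of "\<phi> x" "\<psi> x"]
    by (simp add: distrib_right)
  moreover have "linear (\<phi> + \<psi>)" using lin by (intro linearI) (simp_all add: linear_add linear_scale algebra_simps)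
  ultimately show "\<phi> + \<psi> \<in> norm_dual u" unfolding norm_dual_def by blast
next
  fix c \<phi> assume "\<phi> \<in> norm_dual u"
  then obtain C where lin: "linear \<phi>" and C: "\<And>x. \<bar>\<phi> x\<bar> \<le> C * unit_norm u x"
    by (auto simp: norm_dual_def)
  have "\<bar>(c *\<^sub>R \<phi>) x\<bar> \<le> (\<bar>c\<bar> * C) * unit_norm u x" for x
    using mult_left_mono[OF C[of x], of "\<bar>c\<bar>"] by (simp add: scaleR_fun_def abs_mult mult.assoc)
  moreover have "linear (c *\<^sub>R \<phi>)"
    using lin by (intro linearI) (simp_all add: scaleR_fun_def linear_add linear_scale algebra_simps)
  ultimately show "c *\<^sub>R \<phi> \<in> norm_dual u" unfolding norm_dual_def by blast
qed

lemma weak_star_closure_of: "weak_star u closure_of S = norm_dual u \<inter> closure (norm_dual u \<inter> S)"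
  by (simp add: weak_star_def closure_of_subtopology)

lemma Lambda_bar_subset_norm_dual: "Lambda_bar u \<subseteq> norm_dual u"
  by (simp add: Lambda_bar_def weak_star_closure_of)

lemma closed_evaluation_zero: "closed {\<phi> :: 'a \<Rightarrow> real. \<phi> x = 0}"
  by (intro closed_Collect_eq continuous_on_product_coordinates continuous_on_const)

lemma pure_states_subset_Lambda_bar: "pure_states u \<subseteq> Lambda_bar u"
proof -
  have "pure_states u \<subseteq> norm_dual u"
    unfolding pure_states_def extreme_point_of_def states_def dual_cone_def by blast
  then show ?thesis
    using closure_subset[of "pure_states u"]
    by (simp add: Lambda_bar_def weak_star_closure_of Int_absorb1)
qed

text \<open>Vanishing of the product is a closed condition on \<open>\<phi>\<close>, so it passes
  from the pure states to their closure.\<close>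

lemma disjoint_iff_Lambda_bar:
  fixes u :: "'a::ordered_real_vector"
  assumes archimedean: "\<forall>x y :: 'a. (\<forall>n::nat. real n *\<^sub>R x \<le> y) \<longrightarrow> x \<le> 0"
    and unit: "is_order_unit u"
  shows "disjoint_in UNIV x y \<longleftrightarrow> (\<forall>\<phi>\<in>Lambda_bar u. \<phi> x * \<phi> y = 0)"
proof -
  have "closed {\<phi> :: 'a \<Rightarrow> real. \<phi> x * \<phi> y = 0}"
    by (intro closed_Collect_eq continuous_on_mult continuous_on_product_coordinates
        continuous_on_const)
  then have "Lambda_bar u \<subseteq> {\<phi>. \<phi> x * \<phi> y = 0}"
    if "\<forall>\<phi>\<in>pure_states u. \<phi> x * \<phi> y = 0"
    using that closure_minimal[of "norm_dual u \<inter> pure_states u" "{\<phi>. \<phi> x * \<phi> y = 0}"]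
    unfolding Lambda_bar_def weak_star_closure_of by blast
  then show ?thesis
    unfolding disjoint_iff_pure_states[OF archimedean unit]
    using pure_states_subset_Lambda_bar by blast
qed

section \<open>Finite interpolation and saturation as a double annihilator\<close>

text \<open>A basic open set of the product topology constrains only finitely many coordinates;
  \<open>e\<close> is a common radius for them.\<close>

lemma not_in_closure_pointwiseE:
  fixes \<phi> :: "'a \<Rightarrow> real"
  assumes "\<phi> \<notin> closure S"
  obtains F e where "finite F" "0 < e" "\<And>\<psi>. \<psi> \<in> S \<Longrightarrow> \<exists>x\<in>F. e \<le> \<bar>\<psi> x - \<phi> x\<bar>"
proof -
  have "openin (product_topology (\<lambda>i::'a. euclidean :: real topology) UNIV) (- closure S)"
    using open_fun_def by (metis closed_closure open_Compl)
  then obtain X where X: "\<phi> \<in> (\<Pi>\<^sub>E i\<in>UNIV. X i)" "\<And>i. open (X i)" "finite {i. X i \<noteq> UNIV}"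
      "(\<Pi>\<^sub>E i\<in>UNIV. X i) \<subseteq> - closure S"
    using product_topology_open_contains_basis[of "\<lambda>i::'a. euclidean :: real topology" UNIV "- closure S" \<phi>]
      assms by auto
  have "\<exists>e>0. \<forall>r. \<bar>r - \<phi> i\<bar> < e \<longrightarrow> r \<in> X i" for i
    using X(1) X(2)[of i] unfolding open_dist by (auto simp: PiE_iff dist_real_def)
  then obtain d where d: "\<And>i. 0 < d i" "\<And>i r. \<bar>r - \<phi> i\<bar> < d i \<Longrightarrow> r \<in> X i" by metis
  define F where "F = {i. X i \<noteq> UNIV}"
  \<comment> \<open>Inserting 1 keeps the minimum meaningful when no coordinate is
    constrained.\<close>
  define e where "e = Min (insert 1 (d ` F))"
  have fin: "finite (insert 1 (d ` F))" using X(3) by (simp add: F_def)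
  then have "0 < e" using d(1) by (auto simp: e_def)
  moreover have "\<exists>x\<in>F. e \<le> \<bar>\<psi> x - \<phi> x\<bar>" if \<psi>: "\<psi> \<in> S" for \<psi>
  proof (rule ccontr)
    assume "\<not> (\<exists>x\<in>F. e \<le> \<bar>\<psi> x - \<phi> x\<bar>)"
    moreover have "e \<le> d i" if "i \<in> F" for i using fin that by (auto simp: e_def intro: Min_le)
    ultimately have "\<psi> i \<in> X i" if "i \<in> F" for i
      using that by (intro d(2)) fastforce
    then have "\<psi> i \<in> X i" for i by (cases "i \<in> F") (auto simp: F_def)
    then have "\<psi> \<in> - closure S" using X(4) by (auto simp: PiE_iff)
    then show False using \<psi> closure_subset by blast
  qed
  ultimately show ?thesis using that X(3) F_def by blast
qed

text \<open>This is the fact that a functional vanishing on the common kernel of finitely many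
  functionals is a combination of them, applied to evaluations acting on \<open>S\<close>. The
  induction passes to the subspace where the evaluation at \<open>b\<close> vanishes.\<close>

lemma evaluation_in_span:
  fixes S :: "('v::real_vector \<Rightarrow> real) set"
  assumes "finite F" "subspace S" "\<And>m. m \<in> S \<Longrightarrow> linear m"
    and "\<And>m. \<lbrakk>m \<in> S; \<forall>x\<in>F. m x = 0\<rbrakk> \<Longrightarrow> m a = 0"
  shows "\<exists>x\<in>span F. \<forall>m\<in>S. m a = m x"
  using assms
proof (induction F arbitrary: S rule: finite_induct)
  case empty
  then show ?case by (auto simp: linear_0)
next
  case (insert b F)
  define T where "T = {m \<in> S. m b = 0}"
  have "subspace T"
    using \<open>subspace S\<close> unfolding T_def subspace_def by (auto simp: scaleR_fun_def)
  then have "\<exists>x\<in>span F. \<forall>m\<in>T. m a = m x"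
    using insert.prems by (intro insert.IH) (auto simp: T_def)
  then obtain x where x: "x \<in> span F" and T: "\<And>m. m \<in> T \<Longrightarrow> m a = m x" by blast
  have xF: "x \<in> span (insert b F)" using x span_mono[of F "insert b F"] by blast
  show ?case
  proof (cases "T = S")
    case True
    then show ?thesis using xF T by blast
  next
    case False
    then obtain n where n: "n \<in> S" "n b \<noteq> 0" by (auto simp: T_def)
    \<comment> \<open>The value of \<open>c\<close> makes the evaluations at \<open>a\<close> and
      \<open>x + c *\<^sub>R b\<close> agree on \<open>n\<close>. They already agree on
      \<open>T\<close>, and \<open>T\<close> together with \<open>n\<close> spans
      \<open>S\<close>.\<close>
    define c where "c = (n a - n x) / n b"
    have "m a = m (x + c *\<^sub>R b)" if m: "m \<in> S" for m
    proof -
      have "m - (m b / n b) *\<^sub>R n \<in> T"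
        unfolding T_def using m n \<open>subspace S\<close>
        by (auto intro: subspace_diff subspace_scale) (simp add: scaleR_fun_def)
      from T[OF this] have "m a - (m b / n b) * n a = m x - (m b / n b) * n x"
        by (simp add: scaleR_fun_def)
      then have "m a - m x = (m b / n b) * (n a - n x)"
        unfolding right_diff_distrib by linarith
      then show ?thesis
        using insert.prems(2)[OF m] n(2) by (simp add: linear_add linear_scale c_def diff_eq_eq add.commute)
    qed
    moreover have "x + c *\<^sub>R b \<in> span (insert b F)"
      using xF by (simp add: span_add span_scale span_base)
    ultimately show ?thesis by blast
  qed
qed

text \<open>A functional in the double annihilator of \<open>S\<close> is matched exactly by
  \<open>S\<close> on any finite set. If the evaluation at the new point \<open>b\<close> depends on
  the earlier ones, then \<open>S\<close>, and hence \<open>\<phi>\<close>, annihilates the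
  difference \<open>b - x\<close>.\<close>

lemma finite_interpolation:
  fixes S :: "('v::real_vector \<Rightarrow> real) set"
  assumes "finite F" and S: "subspace S" "\<And>m. m \<in> S \<Longrightarrow> linear m" and \<phi>: "linear \<phi>"
    and kernel: "\<And>x. (\<And>m. m \<in> S \<Longrightarrow> m x = 0) \<Longrightarrow> \<phi> x = 0"
  shows "\<exists>\<psi>\<in>S. \<forall>x\<in>F. \<psi> x = \<phi> x"
  using \<open>finite F\<close>
proof (induction F rule: finite_induct)
  case empty
  then show ?case using subspace_0[OF S(1)] by blast
next
  case (insert b F)
  then obtain \<psi> where \<psi>: "\<psi> \<in> S" "\<And>x. x \<in> F \<Longrightarrow> \<psi> x = \<phi> x" by blast
  show ?case
  proof (cases "\<exists>m\<in>S. (\<forall>x\<in>F. m x = 0) \<and> m b \<noteq> 0")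
    case True
    then obtain m where m: "m \<in> S" "\<And>x. x \<in> F \<Longrightarrow> m x = 0" "m b \<noteq> 0" by blast
    \<comment> \<open>Adding a multiple of \<open>m\<close> corrects the value at \<open>b\<close>
      without disturbing the values on \<open>F\<close>, where \<open>m\<close> vanishes.\<close>
    define \<psi>' where "\<psi>' = \<psi> + ((\<phi> b - \<psi> b) / m b) *\<^sub>R m"
    have "\<psi>' \<in> S" unfolding \<psi>'_def using \<psi> m S by (intro subspace_add subspace_scale)
    moreover have "\<forall>x\<in>insert b F. \<psi>' x = \<phi> x"
      using \<psi> m by (auto simp: \<psi>'_def scaleR_fun_def)
    ultimately show ?thesis by blast
  next
    case False
    then have "\<exists>x\<in>span F. \<forall>m\<in>S. m b = m x"
      using S by (intro evaluation_in_span[OF insert.hyps(1)]) blast+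
    then obtain x where x: "x \<in> span F" "\<And>m. m \<in> S \<Longrightarrow> m b = m x" by blast
    have "\<phi> (b - x) = 0" using x S by (intro kernel) (simp add: linear_diff)
    then have "\<phi> b = \<phi> x" using \<phi> by (simp add: linear_diff)
    moreover have "\<psi> x = \<phi> x" by (rule linear_eq_on_span[OF S(2)[OF \<psi>(1)] \<phi> \<psi>(2) x(1)])
    ultimately have "\<psi> b = \<phi> b" using x(2)[OF \<psi>(1)] by simp
    then have "\<forall>x\<in>insert b F. \<psi> x = \<phi> x" using \<psi>(2) by blast
    then show ?thesis using \<psi>(1) by blast
  qed
qed

text \<open>Vanishing at \<open>x\<close> is inherited by linear combinations and by limits.
  Conversely, a neighbourhood tests finitely many coordinates, and these are matched exactly by
  interpolation within \<open>span M\<close>.\<close>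

lemma sat_eq_bipolar:
  assumes M: "M \<subseteq> norm_dual u"
  shows "sat u M = {\<phi> \<in> Lambda_bar u. \<forall>x. (\<forall>m\<in>M. m x = 0) \<longrightarrow> \<phi> x = 0}"
proof (intro set_eqI iffI)
  fix \<phi> assume \<phi>: "\<phi> \<in> sat u M"
  have "\<phi> x = 0" if x: "\<forall>m\<in>M. m x = 0" for x
  proof -
    have "m x = 0" if "m \<in> span M" for m
      using that
    proof (induction rule: span_induct_alt)
      case (step c m n)
      then show ?case using x by (simp add: scaleR_fun_def)
    qed simp
    then have "closure (norm_dual u \<inter> span M) \<subseteq> {\<phi>. \<phi> x = 0}"
      by (intro closure_minimal closed_evaluation_zero) auto
    then show ?thesis using \<phi> by (auto simp: sat_def weak_star_closure_of)
  qed
  then show "\<phi> \<in> {\<phi> \<in> Lambda_bar u. \<forall>x. (\<forall>m\<in>M. m x = 0) \<longrightarrow> \<phi> x = 0}"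
    using \<phi> by (simp add: sat_def)
next
  fix \<phi> assume "\<phi> \<in> {\<phi> \<in> Lambda_bar u. \<forall>x. (\<forall>m\<in>M. m x = 0) \<longrightarrow> \<phi> x = 0}"
  then have \<phi>: "\<phi> \<in> Lambda_bar u" and kernel: "\<And>x. (\<And>m. m \<in> M \<Longrightarrow> m x = 0) \<Longrightarrow> \<phi> x = 0"
    by auto
  have span: "span M \<subseteq> norm_dual u" using M subspace_norm_dual by (rule span_minimal)
  have "\<phi> \<in> norm_dual u" using \<phi> Lambda_bar_subset_norm_dual by blast
  have "\<phi> \<in> closure (span M)"
  proof (rule ccontr)
    assume "\<phi> \<notin> closure (span M)"
    then obtain F e where F: "finite F" "0 < e" and far: "\<And>\<psi>. \<psi> \<in> span M \<Longrightarrow> \<exists>x\<in>F. e \<le> \<bar>\<psi> x - \<phi> x\<bar>"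
      by (rule not_in_closure_pointwiseE) auto
    have "\<exists>\<psi>\<in>span M. \<forall>x\<in>F. \<psi> x = \<phi> x"
    proof (rule finite_interpolation[OF F(1) subspace_span])
      show "linear \<phi>" using \<open>\<phi> \<in> norm_dual u\<close> by (rule norm_dual_linear)
      show "linear m" if "m \<in> span M" for m using that span norm_dual_linear by blast
      show "\<phi> x = 0" if "\<And>m. m \<in> span M \<Longrightarrow> m x = 0" for x
        using that by (intro kernel) (simp add: span_base)
    qed
    then show False using far F(2) by fastforce
  qed
  then show "\<phi> \<in> sat u M"
    using \<phi> \<open>\<phi> \<in> norm_dual u\<close> span by (simp add: sat_def weak_star_closure_of Int_absorb1)
qed

section \<open>Ideals of continuous functions\<close>

lemma Phi_in_cont_fun: "Phi u x \<in> cont_fun u"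
proof -
  have "continuous_on (Lambda_bar u) (\<lambda>\<phi>. \<phi> x)"
    by (rule continuous_on_subset[OF continuous_on_product_coordinates]) simp
  then have "continuous_on (Lambda_bar u) (Phi u x)"
    by (rule continuous_on_eq) (simp add: Phi_def)
  then show ?thesis by (simp add: cont_fun_def Phi_def)
qed

text \<open>The absolute values of \<open>f + g\<close> and \<open>f - g\<close> are themselves
  continuous and serve as upper bounds, so equality of the sets of upper bounds makes each dominate
  the other.\<close>

lemma disjoint_in_cont_fun_iff:
  assumes f: "f \<in> cont_fun u" and g: "g \<in> cont_fun u"
  shows "disjoint_in (cont_fun u) f g \<longleftrightarrow> (\<forall>\<phi>. f \<phi> * g \<phi> = 0)"
proof
  have ub: "w \<in> upper_bounds W {h, - h} \<longleftrightarrow> w \<in> W \<and> (\<forall>\<phi>. \<bar>h \<phi>\<bar> \<le> w \<phi>)"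
    for W and w h :: "('a \<Rightarrow> real) \<Rightarrow> real"
    by (auto simp: upper_bounds_def le_fun_def abs_le_iff)
  have dis: "disjoint_in (cont_fun u) f g \<longleftrightarrow>
      upper_bounds (cont_fun u) {f + g, - (f + g)} = upper_bounds (cont_fun u) {f - g, - (f - g)}"
    by (simp add: disjoint_in_def)
  {
    assume d: "disjoint_in (cont_fun u) f g"
    show "\<forall>\<phi>. f \<phi> * g \<phi> = 0"
    proof
      fix \<phi>
      have "(\<lambda>\<phi>. \<bar>f \<phi> + g \<phi>\<bar>) \<in> cont_fun u" "(\<lambda>\<phi>. \<bar>f \<phi> - g \<phi>\<bar>) \<in> cont_fun u"
        using f g by (auto simp: cont_fun_def intro!: continuous_intros)
      then have "(\<lambda>\<phi>. \<bar>f \<phi> + g \<phi>\<bar>) \<in> upper_bounds (cont_fun u) {f - g, - (f - g)}"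
          "(\<lambda>\<phi>. \<bar>f \<phi> - g \<phi>\<bar>) \<in> upper_bounds (cont_fun u) {f + g, - (f + g)}"
        using d unfolding dis by (simp_all only: ub set_eq_iff) auto
      then have "\<bar>f \<phi> + g \<phi>\<bar> = \<bar>f \<phi> - g \<phi>\<bar>"
        unfolding ub by (auto intro: antisym)
      then show "f \<phi> * g \<phi> = 0" by (simp only: abs_add_eq_abs_diff_iff)
    qed
  next
    assume "\<forall>\<phi>. f \<phi> * g \<phi> = 0"
    then have "\<bar>f \<phi> + g \<phi>\<bar> = \<bar>f \<phi> - g \<phi>\<bar>" for \<phi> by (simp only: abs_add_eq_abs_diff_iff)
    then show "disjoint_in (cont_fun u) f g" unfolding dis set_eq_iff ub by simp
  }
qed

lemma disjoint_compl_cont_fun: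
  assumes "S \<subseteq> cont_fun u"
  shows "disjoint_compl (cont_fun u) S = {f \<in> cont_fun u. \<forall>\<phi>\<in>car u S. f \<phi> = 0}"
proof -
  have "(\<forall>s\<in>S. disjoint_in (cont_fun u) s f) \<longleftrightarrow> (\<forall>\<phi>\<in>car u S. f \<phi> = 0)" if "f \<in> cont_fun u" for f
  proof -
    have "(\<forall>s\<in>S. disjoint_in (cont_fun u) s f) \<longleftrightarrow> (\<forall>s\<in>S. \<forall>\<phi>. s \<phi> * f \<phi> = 0)"
      using disjoint_in_cont_fun_iff that assms by (metis subsetD)
    also have "\<dots> \<longleftrightarrow> (\<forall>\<phi>\<in>car u S. f \<phi> = 0)"
      using that by (fastforce simp: car_def cont_fun_def)
    finally show ?thesis .
  qed
  then show ?thesis by (auto simp: disjoint_compl_def)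
qed

lemma is_ideal_vanishing: "is_ideal u {f \<in> cont_fun u. \<forall>\<phi>\<in>N. f \<phi> = 0}"
  unfolding is_ideal_def
proof (intro conjI ballI impI)
  show "subspace {f \<in> cont_fun u. \<forall>\<phi>\<in>N. f \<phi> = 0}"
    unfolding subspace_def
    by (auto simp: cont_fun_def scaleR_fun_def zero_fun_def plus_fun_def intro!: continuous_intros)
next
  fix f g assume f: "f \<in> cont_fun u" and g: "g \<in> {f \<in> cont_fun u. \<forall>\<phi>\<in>N. f \<phi> = 0}"
    and le: "\<forall>\<phi>\<in>Lambda_bar u. \<bar>f \<phi>\<bar> \<le> \<bar>g \<phi>\<bar>"
  have "f \<phi> = 0" if \<phi>: "\<phi> \<in> N" for \<phi>
  proof (cases "\<phi> \<in> Lambda_bar u")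
    case True
    then have "\<bar>f \<phi>\<bar> \<le> \<bar>g \<phi>\<bar>" using le by blast
    then show ?thesis using g \<phi> by simp
  qed (use f in \<open>simp add: cont_fun_def\<close>)
  then show "f \<in> {f \<in> cont_fun u. \<forall>\<phi>\<in>N. f \<phi> = 0}" using f by simp
qed auto

text \<open>The zero set of a continuous function is relatively closed, so vanishing on
  \<open>N\<close> extends to its closure. Every point off the closure is separated from
  \<open>N\<close> by a bump function.\<close>

lemma car_vanishing:
  assumes N: "N \<subseteq> Lambda_bar u"
  shows "car u {f \<in> cont_fun u. \<forall>\<phi>\<in>N. f \<phi> = 0} = Lambda_bar u - weak_star u closure_of N"
proof (intro set_eqI iffI)
  fix \<phi> assume "\<phi> \<in> car u {f \<in> cont_fun u. \<forall>\<phi>\<in>N. f \<phi> = 0}"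
  then have "\<phi> \<in> Lambda_bar u" and "\<exists>f\<in>{f \<in> cont_fun u. \<forall>\<phi>\<in>N. f \<phi> = 0}. f \<phi> \<noteq> 0"
    by (simp_all only: car_def mem_Collect_eq)
  from this(2) obtain f where "f \<in> {f \<in> cont_fun u. \<forall>\<phi>\<in>N. f \<phi> = 0}" "f \<phi> \<noteq> 0" ..
  with \<open>\<phi> \<in> Lambda_bar u\<close> have \<phi>: "\<phi> \<in> Lambda_bar u" "f \<phi> \<noteq> 0"
    and f: "continuous_on (Lambda_bar u) f" and f0: "\<forall>\<psi>\<in>N. f \<psi> = 0"
    by (simp_all add: cont_fun_def)
  obtain T where T: "closed T" "{\<psi> \<in> Lambda_bar u. f \<psi> = 0} = Lambda_bar u \<inter> T"
    using continuous_closedin_preimage_constant[OF f, of 0] by (auto simp: closedin_closed)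
  have "N \<subseteq> T" using T(2) f0 N by blast
  then have "closure N \<subseteq> T" using T(1) by (rule closure_minimal)
  moreover have "\<phi> \<notin> T" using T(2) \<phi> by blast
  ultimately have "\<phi> \<notin> closure (norm_dual u \<inter> N)"
    using closure_mono[of "norm_dual u \<inter> N" N] by blast
  then show "\<phi> \<in> Lambda_bar u - weak_star u closure_of N"
    using \<phi> by (simp add: weak_star_closure_of)
next
  fix \<phi> assume \<phi>: "\<phi> \<in> Lambda_bar u - weak_star u closure_of N"
  have "N \<subseteq> norm_dual u" using N Lambda_bar_subset_norm_dual by blast
  then have "\<phi> \<notin> closure N"
    using \<phi> Lambda_bar_subset_norm_dual by (auto simp: weak_star_closure_of Int_absorb1)
  then obtain F e where F: "finite F" "0 < e" and far: "\<And>\<psi>. \<psi> \<in> N \<Longrightarrow> \<exists>x\<in>F. e \<le> \<bar>\<psi> x - \<phi> x\<bar>"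
    by (rule not_in_closure_pointwiseE) auto
  \<comment> \<open>A tent with peak value \<open>e\<close> at \<open>\<phi>\<close>. At a point of
    \<open>N\<close> one summand alone is at least \<open>e\<close>, so the tent vanishes
    there.\<close>
  define h where "h = (\<lambda>\<psi>. max 0 (e - (\<Sum>x\<in>F. \<bar>\<psi> x - \<phi> x\<bar>)))"
  define f where "f = (\<lambda>\<psi>. if \<psi> \<in> Lambda_bar u then h \<psi> else 0)"
  have "continuous_on UNIV h"
    unfolding h_def
    by (intro continuous_on_max continuous_on_diff continuous_on_sum continuous_on_rabs
        continuous_on_const continuous_on_product_coordinates)
  then have "continuous_on (Lambda_bar u) h" by (rule continuous_on_subset) simp
  then have "continuous_on (Lambda_bar u) f" by (rule continuous_on_eq) (simp add: f_def)
  then have "f \<in> cont_fun u" by (simp add: cont_fun_def f_def)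
  moreover have "f \<psi> = 0" if \<psi>: "\<psi> \<in> N" for \<psi>
  proof -
    obtain x where x: "x \<in> F" "e \<le> \<bar>\<psi> x - \<phi> x\<bar>" using far[OF \<psi>] by blast
    have "\<bar>\<psi> x - \<phi> x\<bar> \<le> (\<Sum>x\<in>F. \<bar>\<psi> x - \<phi> x\<bar>)"
      using member_le_sum[OF x(1) _ F(1), of "\<lambda>x. \<bar>\<psi> x - \<phi> x\<bar>"] by simp
    then show ?thesis using x(2) by (simp add: f_def h_def)
  qed
  moreover have "f \<phi> \<noteq> 0" using \<phi> F(2) by (simp add: f_def h_def)
  ultimately show "\<phi> \<in> car u {f \<in> cont_fun u. \<forall>\<phi>\<in>N. f \<phi> = 0}"
    using \<phi> unfolding car_def mem_Collect_eq by (intro conjI bexI[of _ f]) simp_all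
qed

text \<open>Maximality holds because \<open>N\<close> lies in its closure: a carrier avoiding that
  closure forces every member of the ideal to vanish on \<open>N\<close>.\<close>

lemma is_largest_ideal_vanishing:
  assumes N: "N \<subseteq> Lambda_bar u"
  shows "is_largest_ideal_with_car u (Lambda_bar u - weak_star u closure_of N)
    {f \<in> cont_fun u. \<forall>\<phi>\<in>N. f \<phi> = 0}"
  unfolding is_largest_ideal_with_car_def
proof (intro conjI allI impI is_ideal_vanishing car_vanishing[OF N])
  fix J assume J: "is_ideal u J \<and> car u J = Lambda_bar u - weak_star u closure_of N"
  have "N \<subseteq> norm_dual u" using N Lambda_bar_subset_norm_dual by blast
  then have "N \<subseteq> weak_star u closure_of N"
    using closure_subset by (auto simp: weak_star_closure_of Int_absorb1)
  then have "f \<phi> = 0" if "f \<in> J" "\<phi> \<in> N" for f \<phi>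
    using J that N unfolding car_def by blast
  moreover have "J \<subseteq> cont_fun u" using J by (simp add: is_ideal_def)
  ultimately show "J \<subseteq> {f \<in> cont_fun u. \<forall>\<phi>\<in>N. f \<phi> = 0}" by blast
qed

lemma car_Phi: "car u (Phi u ` B) = {\<phi> \<in> Lambda_bar u. \<exists>b\<in>B. \<phi> b \<noteq> 0}"
  by (auto simp: car_def Phi_def)

text \<open>By pointwise disjointness, the disjoint complement of \<open>B\<close> is the
  annihilator of its carrier; a point lies off the carrier of this annihilator exactly when it
  belongs to the double annihilator.\<close>

lemma car_Phi_disjoint_compl:
  fixes u :: "'a::ordered_real_vector"
  assumes archimedean: "\<forall>x y :: 'a. (\<forall>n::nat. real n *\<^sub>R x \<le> y) \<longrightarrow> x \<le> 0"
    and unit: "is_order_unit u"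
  shows "car u (Phi u ` disjoint_compl UNIV B) = Lambda_bar u - sat u (car u (Phi u ` B))"
proof -
  have "disjoint_compl UNIV B = {y. \<forall>m\<in>car u (Phi u ` B). m y = 0}"
    unfolding disjoint_compl_def disjoint_iff_Lambda_bar[OF archimedean unit] car_Phi mult_eq_0_iff
    by blast
  moreover have "car u (Phi u ` B) \<subseteq> norm_dual u"
    using Lambda_bar_subset_norm_dual by (auto simp: car_Phi)
  ultimately show ?thesis
    unfolding car_Phi[of u "disjoint_compl UNIV B"] by (simp only: sat_eq_bipolar) blast
qed

theorem theorem20:
  fixes u :: "'a::ordered_real_vector" and B :: "'a set"
  assumes archimedean: "\<And>x y :: 'a. (\<And>n::nat. real n *\<^sub>R x \<le> y) \<Longrightarrow> x \<le> 0"
    and unit: "is_order_unit u"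
    and band: "is_band UNIV B"
  defines "I \<equiv> disjoint_compl (cont_fun u) (Phi u ` disjoint_compl UNIV B)"
    and "U \<equiv> Lambda_bar u -
           weak_star u closure_of (Lambda_bar u - sat u (car u (Phi u ` B)))"
  shows "car u I = U \<and> is_largest_ideal_with_car u U I"
proof -
  have arch: "\<forall>x y :: 'a. (\<forall>n::nat. real n *\<^sub>R x \<le> y) \<longrightarrow> x \<le> 0"
  proof (intro allI impI)
    fix x y :: 'a assume "\<forall>n::nat. real n *\<^sub>R x \<le> y"
    then have "\<And>n::nat. real n *\<^sub>R x \<le> y" ..
    then show "x \<le> 0" by (rule archimedean)
  qed
  \<comment> \<open>Reading the complement of the saturation as a carrier makes this an instance of
    the description of disjoint complements in \<open>cont_fun u\<close>.\<close>
  have "I = {f \<in> cont_fun u. \<forall>\<phi>\<in>Lambda_bar u - sat u (car u (Phi u ` B)). f \<phi> = 0}"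
    unfolding I_def car_Phi_disjoint_compl[OF arch unit, symmetric]
    by (rule disjoint_compl_cont_fun) (auto simp: Phi_in_cont_fun)
  then show ?thesis
    unfolding U_def using is_largest_ideal_vanishing[of "Lambda_bar u - sat u (car u (Phi u ` B))" u]
    by (simp add: is_largest_ideal_with_car_def)
qed

end
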